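(* Let $\mathbb{T}$ be a time scale and let $a,b\in\mathbb{T}$ with $a<b$. Let $\nu:[a,b]\to[0,\infty)$ be $rd$-continuous and positive, let $w:[a,b]\to\mathbb{R}$ be delta-differentiable with $w^{\Delta}(t)=\nu(t)$ on $[a,b]$, let $f:[a,b]\to\mathbb{R}$ be twice delta-differentiable, and let $\psi:[0,1]\to[0,1]$ be a function. For $\lambda\in[0,1]$ and $s,t\in[a,b]$ put $$\Phi(\lambda)=\frac{1+\psi(1-\lambda)-\psi(\lambda)}{2},\qquad K(s,t)=\begin{cases} w(s)-\left(w(a)+\psi(\lambda)\frac{w(b)-w(a)}{2}\right), & s\in[a,t),\\ w(s)-\left(w(a)+(1+\psi(1-\lambda))\frac{w(b)-w(a)}{2}\right), & s\in[t,b],\end{cases}$$ and assume $M=\sup_{a<t<b}|f^{\Delta\Delta}(t)|<\infty$. Then for all $x\in[a,b]$ and all $\lambda\in[0,1]$, $$\begin{aligned} &\Bigg|\Phi^2(\lambda)f(x)-\frac{1}{\left(\int_a^b\nu(t)\Delta t\right)^2}\left(\int_a^bK(t,x)\Delta t\right)\left(\int_a^b\nu(s)f^{\Delta}(\sigma(s))\Delta s\right)\\ &\quad+\frac{\psi(\lambda)f^{\Delta}(a)+(1-\psi(1-\lambda))f^{\Delta}(b)}{2\int_a^b\nu(t)\Delta t}\int_a^bK(t,x)\Delta t\\ &\quad-\frac{\Phi(\lambda)}{\int_a^b\nu(t)\Delta t}\int_a^b\nu(t)f(\sigma(t))\Delta t+\frac{\psi(\lambda)f(a)+(1-\psi(1-\lambda))f(b)}{2}\Phi(\lambda)\Bigg|\\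 &\le\frac{M}{\left(\int_a^b\nu(t)\Delta t\right)^2}\int_a^b\int_a^b|K(t,x)|\,|K(s,t)|\,\Delta s\,\Delta t. \end{aligned}$$
   Context: A time scale $\mathbb{T}$ is a nonempty closed subset of $\mathbb{R}$ with the subspace topology; $[a,b]$ denotes $\{t\in\mathbb{T}: a\le t\le b\}$ (similarly for half-open and open intervals). The forward and backward jump operators are $\sigma(t)=\inf\{s\in\mathbb{T}:s>t\}$ and $\rho(t)=\sup\{s\in\mathbb{T}:s<t\}$. A point $t$ is right-scattered if $\sigma(t)>t$, right-dense if $\sigma(t)=t$, left-scattered if $\rho(t)<t$, left-dense if $\rho(t)=t$. $\mathbb{T}^{\kappa}=\mathbb{T}\setminus\{m\}$ if $\mathbb{T}$ has a left-scattered maximum $m$, and $\mathbb{T}^\kappa=\mathbb{T}$ otherwise. The delta derivative $f^{\Delta}(t)$ of $f:\mathbb{T}\to\mathbb{R}$ at $t\in\mathbb{T}^{\kappa}$ is the number (if it exists) such that for every $\epsilon>0$ there is a neighborhood $U$ of $t$ with $|f(\sigma(t))-f(s)-f^{\Delta}(t)(\sigma(t)-s)|\le\epsilon|\sigma(t)-s|$ for all $s\in U$; $f^{\Delta\Delta}=(f^\Delta)^\Delta$. A function is $rd$-continuous if it is continuous at all right-dense points and has finite left-sided limits at all left-dense points. If $F^{\Delta}=f$ then $\int_a^bf(s)\Delta s:=F(b)-F(a)$; for integrands with no such antiderivative (e.g. functions with a jump at $x$) the integral is the usual Lebesgue $\Delta$-integral on $[a,b)$, which extends this definition for $rd$-continuous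 functions. It is understood that the values $f^\Delta(a)$, $f^\Delta(b)$ exist (if $b$ is right-scattered, $f^\Delta(b)$ uses the value $f(\sigma(b))$).
   Formalization: If a is right-scattered, the supremum defining M is taken over a≤t<b instead of a<t<b; with a left out the inequality fails (e.g. T the integers, a=0, b=x=2, ψ=1, w(t)=t, f(0)=f(1)=0, f(2)=1, f(3)=2: left side 1/2, right side 0). *)

theory Defs
  imports "HOL-Analysis.Analysis"
begin

(* Conventions at the ends of the time scale: inf {} = sup T and sup {} = inf T.
   These functions are total on the reals; off T, fwd_jump T x is the next point of T after x. *)

definition fwd_jump :: "real set \<Rightarrow> real \<Rightarrow> real" where
  "fwd_jump T t = (if \<exists>s\<in>T. t < s then Inf {s\<in>T. t < s} else t)"

definition bwd_jump :: "real set \<Rightarrow> real \<Rightarrow> real" where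
  "bwd_jump T t = (if \<exists>s\<in>T. s < t then Sup {s\<in>T. s < t} else t)"

definition time_scale :: "real set \<Rightarrow> bool" where
  "time_scale T \<longleftrightarrow> closed T \<and> T \<noteq> {}"

definition ts_kappa :: "real set \<Rightarrow> real set" where
  "ts_kappa T = {t\<in>T. \<not> (bwd_jump T t < t \<and> (\<forall>s\<in>T. s \<le> t))}"

(* Delta derivative at t of a function whose domain is the subset X of T: the neighbourhoods
   of t are taken in X, while the jump operator and the restriction to ts_kappa are those of T.
   At a right-scattered point the value of f at fwd_jump T t is used, even when that point lies
   outside X.  X = T is the usual delta derivative. *)

definition has_delta_derivative ::
  "real set \<Rightarrow> real set \<Rightarrow> (real \<Rightarrow> real) \<Rightarrow> real \<Rightarrow> real \<Rightarrow> bool" where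
  "has_delta_derivative T X f D t \<longleftrightarrow> t \<in> X \<and> t \<in> ts_kappa T \<and>
     (\<forall>\<epsilon>>0. \<exists>\<delta>>0. \<forall>s\<in>X. \<bar>s - t\<bar> < \<delta> \<longrightarrow>
        \<bar>f (fwd_jump T t) - f s - D * (fwd_jump T t - s)\<bar> \<le> \<epsilon> * \<bar>fwd_jump T t - s\<bar>)"

definition rd_continuous_on :: "real set \<Rightarrow> real set \<Rightarrow> (real \<Rightarrow> real) \<Rightarrow> bool" where
  "rd_continuous_on T X f \<longleftrightarrow>
     (\<forall>t\<in>X. fwd_jump T t = t \<longrightarrow> continuous (at t within X) f) \<and>
     (\<forall>t\<in>X. bwd_jump T t = t \<longrightarrow> (\<exists>l. (f \<longlongrightarrow> l) (at t within X \<inter> {..<t})))"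

(* The Lebesgue delta-measure is the Lebesgue-Stieltjes measure generated by the
   forward jump operator: on T it assigns d - c to [c,d), for c and d in T
   (delta_measure_Ico below), and in particular fwd_jump T t - t to {t}. *)

definition delta_measure :: "real set \<Rightarrow> real measure" where
  "delta_measure T = interval_measure (fwd_jump T)"

definition delta_integral :: "real set \<Rightarrow> real \<Rightarrow> real \<Rightarrow> (real \<Rightarrow> real) \<Rightarrow> real" where
  "delta_integral T a b f = set_lebesgue_integral (delta_measure T) (T \<inter> {a..<b}) f"

lemma fwd_jump_ge: "t \<le> fwd_jump T t"
proof (cases "\<exists>s\<in>T. t < s")
  case True
  then have "t \<le> Inf {s\<in>T. t < s}" by (intro cInf_greatest) auto
  then show ?thesis using True by (simp add: fwd_jump_def)
qed (simp add: fwd_jump_def)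

lemma fwd_jump_le: "t < s \<Longrightarrow> s \<in> T \<Longrightarrow> fwd_jump T t \<le> s"
  using cInf_lower[of s "{s\<in>T. t < s}"] bdd_belowI[of "{s\<in>T. t < s}" t]
  by (auto simp: fwd_jump_def)

lemma fwd_jump_mono:
  assumes "s \<le> t" shows "fwd_jump T s \<le> fwd_jump T t"
proof (cases "\<exists>u\<in>T. t < u")
  case True
  have "fwd_jump T s \<le> Inf {u\<in>T. t < u}"
    using True assms by (intro cInf_greatest) (auto intro!: fwd_jump_le)
  then show ?thesis using True by (simp add: fwd_jump_def)
next
  case False
  show ?thesis
  proof (cases "\<exists>u\<in>T. s < u")
    case True
    then obtain u where "u \<in> T" "s < u" by blast
    then show ?thesis using False fwd_jump_le[of s u T] fwd_jump_ge[of t T] by fastforce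
  next
    case F: False
    then show ?thesis using False assms by (simp add: fwd_jump_def)
  qed
qed

lemma fwd_jump_in:
  assumes "closed T" "s \<in> T" "t < s" shows "fwd_jump T t \<in> T"
proof -
  have "closure {u\<in>T. t < u} \<subseteq> T"
    using assms(1) by (intro closure_minimal) auto
  moreover have "Inf {u\<in>T. t < u} \<in> closure {u\<in>T. t < u}"
    using assms by (intro closure_contains_Inf bdd_belowI[of _ t]) auto
  ultimately show ?thesis using assms by (auto simp: fwd_jump_def)
qed

lemma fwd_jump_right_continuous: "continuous (at_right x) (fwd_jump T)"
proof -
  have "\<exists>b>x. \<forall>y>x. y < b \<longrightarrow> dist (fwd_jump T y) (fwd_jump T x) < e" if "e > 0" for e
  proof (cases "\<exists>u\<in>T. x < u")
    case True
    then have "\<exists>u\<in>{u\<in>T. x < u}. u < fwd_jump T x + e"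
      using that by (intro cInf_lessD) (auto simp: fwd_jump_def)
    then obtain u where u: "u \<in> T" "x < u" "u < fwd_jump T x + e" by blast
    show ?thesis
    proof (intro exI[of _ u] conjI allI impI)
      fix y assume "x < y" "y < u"
      then show "dist (fwd_jump T y) (fwd_jump T x) < e"
        using fwd_jump_le[of y u T] u fwd_jump_mono[of x y T] by (simp add: dist_real_def)
    qed (use u in auto)
  next
    case False
    then show ?thesis
      using that by (intro exI[of _ "x + e"]) (auto simp: fwd_jump_def dist_real_def)
  qed
  then show ?thesis
    by (auto simp: continuous_within tendsto_iff eventually_at_right_field)
qed

lemma emeasure_delta_Ioc:
  "x \<le> y \<Longrightarrow> emeasure (delta_measure T) {x<..y} = ennreal (fwd_jump T y - fwd_jump T x)"
  unfolding delta_measure_def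
  by (rule emeasure_interval_measure_Ioc) (auto intro: fwd_jump_mono fwd_jump_right_continuous)

lemma sets_delta_measure [simp, measurable_cong]: "sets (delta_measure T) = sets borel"
  by (simp add: delta_measure_def)

lemma emeasure_delta_Ioo:
  assumes "x < t" "t \<in> T"
  shows "emeasure (delta_measure T) {x<..<t} = ennreal (t - fwd_jump T x)"
proof -
  define y where "y n = t - (t - x) / real (Suc n)" for n
  have y: "x \<le> y n" "y n < t" for n
    using assms divide_left_mono[of 1 "real (Suc n)" "t - x"] by (auto simp: y_def)
  have inc: "incseq y"
    using assms by (auto simp: y_def incseq_def intro!: divide_left_mono)
  have lim: "y \<longlonglongrightarrow> t"
    unfolding y_def using tendsto_diff[OF tendsto_const[of t] tendsto_mult[OF tendsto_const[of "t - x"] LIMSEQ_inverse_real_of_nat]] by (simp add: divide_inverse)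
  have un: "(\<Union>n. {x<..y n}) = {x<..<t}"
  proof (intro equalityI subsetI)
    fix z assume z: "z \<in> {x<..<t}"
    then have "\<forall>\<^sub>F n in sequentially. z < y n"
      using lim by (auto simp: order_tendsto_iff)
    then obtain n where "z < y n" by (auto simp: eventually_sequentially)
    then show "z \<in> (\<Union>n. {x<..y n})" using z by (auto intro!: exI[of _ n])
  qed (auto intro: le_less_trans[OF _ y(2)])
  have "(\<lambda>n. emeasure (delta_measure T) {x<..y n}) \<longlonglongrightarrow> emeasure (delta_measure T) (\<Union>n. {x<..y n})"
    using inc by (intro Lim_emeasure_incseq) (auto simp: incseq_def, meson order_trans)
  moreover have "(\<lambda>n. fwd_jump T (y n)) \<longlonglongrightarrow> t"
    using y assms by (intro tendsto_sandwich[OF _ _ lim tendsto_const])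
      (auto intro!: always_eventually fwd_jump_ge fwd_jump_le)
  then have "(\<lambda>n. ennreal (fwd_jump T (y n) - fwd_jump T x)) \<longlonglongrightarrow> ennreal (t - fwd_jump T x)"
    by (intro tendsto_intros)
  then have "(\<lambda>n. emeasure (delta_measure T) {x<..y n}) \<longlonglongrightarrow> ennreal (t - fwd_jump T x)"
    using y by (simp add: emeasure_delta_Ioc)
  ultimately show ?thesis using LIMSEQ_unique un by metis
qed

lemma delta_measure_Ico:
  assumes "closed T" "c \<in> T" "d \<in> T" "c \<le> d"
  shows "emeasure (delta_measure T) (T \<inter> {c..<d}) = ennreal (d - c)"
proof -
  define g where "g r = (let u = fwd_jump T r; p = Sup {s\<in>T. s \<le> r} in {p<..<u})" for r
  have gap: "emeasure (delta_measure T) (g r) = 0 \<and> x \<in> g r" 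
    if "x \<notin> T" "c \<le> x" "x < r" "r < fwd_jump T x" "x < d" for r x
  proof -
    have no: "s \<le> x \<or> r < s" if "s \<in> T" for s
      using that \<open>r < fwd_jump T x\<close> fwd_jump_le[of x s T] by force
    have rd: "r < d" using no[OF assms(3)] \<open>x < d\<close> by auto
    let ?S = "{s\<in>T. s \<le> r}"
    have "Sup ?S \<in> closure ?S"
      using assms that by (intro closure_contains_Sup bdd_aboveI[of _ r]) auto
    moreover have "closure ?S \<subseteq> ?S"
    proof -
      have "?S = T \<inter> {..r}" by auto
      then have "closed ?S" using assms(1) by (simp add: closed_Int)
      then show ?thesis by simp
    qed
    ultimately have p: "Sup ?S \<in> T" "Sup ?S \<le> r" by auto
    have px: "Sup ?S < x" using no[OF p(1)] p that by (cases "Sup ?S = x") auto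
    have le: "s \<le> Sup ?S" if "s \<in> ?S" for s
      using that by (intro cSup_upper bdd_aboveI[of _ r]) auto
    have ur: "r \<le> fwd_jump T r" by (rule fwd_jump_ge)
    have uT: "fwd_jump T r \<in> T" using fwd_jump_in[OF assms(1,3) rd] .
    have "fwd_jump T r \<le> fwd_jump T (Sup ?S)"
    proof -
      have "fwd_jump T (Sup ?S) \<in> T" using fwd_jump_in[OF assms(1,3), of "Sup ?S"] p rd by simp
      moreover have "Inf {s\<in>T. Sup ?S < s} \<ge> fwd_jump T r"
      proof (intro cInf_greatest)
        show "{s\<in>T. Sup ?S < s} \<noteq> {}" using assms(3) p rd by force
        fix s assume s: "s \<in> {s\<in>T. Sup ?S < s}"
        then have "\<not> s \<le> r" using le[of s] by fastforce
        then show "fwd_jump T r \<le> s" using s by (auto intro!: fwd_jump_le)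
      qed
      moreover have "\<exists>s\<in>T. Sup ?S < s" using assms(3) p rd by (intro bexI[of _ d]) auto
      ultimately show ?thesis by (simp add: fwd_jump_def[of T "Sup ?S"])
    qed
    then have "emeasure (delta_measure T) {Sup ?S<..<fwd_jump T r} = 0"
      using emeasure_delta_Ioo[of "Sup ?S" "fwd_jump T r" T] px ur uT \<open>x < r\<close>
      by (simp add: ennreal_neg)
    then show ?thesis using px ur \<open>x < r\<close> by (auto simp: g_def Let_def)
  qed
  define I where "I = {r\<in>\<rat>. emeasure (delta_measure T) (g r) = 0}"
  have "emeasure (delta_measure T) (\<Union>r\<in>I. g r) = 0"
  proof -
    have "countable I" unfolding I_def using countable_rat by (rule countable_subset[rotated]) auto
    moreover have "g r \<in> null_sets (delta_measure T)" if "r \<in> I" for r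
      using that by (auto simp: I_def g_def Let_def null_sets_def)
    ultimately have "(\<Union>r\<in>I. g r) \<in> null_sets (delta_measure T)"
      by (intro null_sets_UN') auto
    then show ?thesis by auto
  qed
  moreover have "{c..<d} - T \<subseteq> (\<Union>r\<in>I. g r)"
  proof
    fix x assume x: "x \<in> {c..<d} - T"
    then have "fwd_jump T x \<in> T" using fwd_jump_in[OF assms(1,3)] by auto
    then have "x < fwd_jump T x" using fwd_jump_ge[of x T] x by (cases "x = fwd_jump T x") auto
    then obtain r where "r \<in> \<rat>" "x < r" "r < fwd_jump T x" using Rats_dense_in_real by blast
    then show "x \<in> (\<Union>r\<in>I. g r)" using gap[of x r] x by (auto simp: I_def)
  qed
  moreover have "(\<Union>r\<in>I. g r) \<in> sets borel"
    by (intro sets.countable_UN'' countable_subset[OF _ countable_rat]) (auto simp: I_def g_def Let_def)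
  ultimately have null: "{c..<d} - T \<in> null_sets (delta_measure T)"
    using assms(1) emeasure_mono[of "{c..<d} - T" "\<Union>r\<in>I. g r" "delta_measure T"]
    by (auto simp: null_sets_def)
  have sx: "fwd_jump T (c - 1) \<le> c" using assms by (intro fwd_jump_le) auto
  have "emeasure (delta_measure T) (T \<inter> {c..<d}) = emeasure (delta_measure T) {c..<d}"
  proof -
    have "{c..<d} = (T \<inter> {c..<d}) \<union> ({c..<d} - T)" by auto
    then show ?thesis
      using emeasure_Un_null_set[OF _ null, of "T \<inter> {c..<d}"] assms(1) by simp
  qed
  also have "\<dots> = emeasure (delta_measure T) ({c-1<..<d} - {c-1<..<c})"
    using assms by (intro arg_cong[where f = "emeasure (delta_measure T)"]) auto
  also have "\<dots> = ennreal (d - fwd_jump T (c-1)) - ennreal (c - fwd_jump T (c-1))"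
    using assms by (subst emeasure_Diff) (auto simp: emeasure_delta_Ioo)
  also have "\<dots> = ennreal (d - c)" using sx assms by (simp add: ennreal_minus)
  finally show ?thesis .
qed

definition montgomery_kernel ::
  "(real \<Rightarrow> real) \<Rightarrow> real \<Rightarrow> real \<Rightarrow> (real \<Rightarrow> real) \<Rightarrow> real \<Rightarrow> real \<Rightarrow> real \<Rightarrow> real" where
  "montgomery_kernel w a b \<psi> l s t =
     (if s < t then w s - (w a + \<psi> l * ((w b - w a) / 2))
      else w s - (w a + (1 + \<psi> (1 - l)) * ((w b - w a) / 2)))"

definition phi_weight :: "(real \<Rightarrow> real) \<Rightarrow> real \<Rightarrow> real" where
  "phi_weight \<psi> l = (1 + \<psi> (1 - l) - \<psi> l) / 2"

(* The set over which the supremum of the second delta derivative is taken: the open interval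
   (a,b) of T, together with a when a is right-scattered.  In that case a is an atom of the
   delta-measure on [a,b), and the bound fails if the supremum leaves it out: take T the
   integers, a = 0, b = 2, x = 2, \<psi> = 1, w(t) = t and f with f(0) = f(1) = 0, f(2) = 1,
   f(3) = 2.  The second difference vanishes at 1, the only point of (a,b), but the left-hand
   side of the inequality is 1/2. *)

definition sup_points :: "real set \<Rightarrow> real \<Rightarrow> real \<Rightarrow> real set" where
  "sup_points T a b = {t\<in>T. a < t \<and> t < b} \<union> (if a < fwd_jump T a then {a} else {})"

end

theory Submission
  imports Defs
begin

text \<open>
  Integration by parts gives the weighted Montgomery identity
  \<open>N (\<Phi> f(x) + A f) - \<integral> \<nu> (f \<circ> \<sigma>) = \<integral> K(t,x) f\<^sup>\<Delta>(t) \<Delta>t\<close> with \<open>N = w(b) - w(a)\<close> and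
  \<open>A f = (\<psi>(\<lambda>) f(a) + (1 - \<psi>(1 - \<lambda>)) f(b)) / 2\<close>. The same identity for \<open>f\<^sup>\<Delta>\<close> turns the left-hand
  side of the theorem into \<open>N\<^sup>-\<^sup>2 \<integral>\<integral> K(t,x) K(s,t) f\<^sup>\<Delta>\<^sup>\<Delta>(s) \<Delta>s \<Delta>t\<close>. Since \<open>f\<^sup>\<Delta>\<^sup>\<Delta>\<close> is only a bounded
  derivative, it is never integrated: the second identity is replaced by the inequality
  \<open>\<bar>N (\<Phi> f\<^sup>\<Delta>(t) + A f\<^sup>\<Delta>) - \<integral> \<nu> (f\<^sup>\<Delta> \<circ> \<sigma>)\<bar> \<le> M \<integral> \<bar>K(s,t)\<bar> \<Delta>s\<close>, which follows from the mean value
  inequality on time scales.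
\<close>

section \<open>Jump points and the algebra of delta derivatives\<close>

lemma fwd_jump_gap: "s \<in> T \<Longrightarrow> s < fwd_jump T t \<Longrightarrow> s \<le> t"
  using fwd_jump_le[of t s T] by force

text \<open>A monotone function has only countably many discontinuities, and
  \<open>fwd_jump T\<close> is discontinuous at a right-scattered \<open>t\<close>: to the left of
  \<open>t\<close> its values are at most \<open>t\<close>, while at \<open>t\<close> it exceeds
  \<open>t\<close>.\<close>

lemma countable_right_scattered: "countable {t\<in>T. t < fwd_jump T t}"
proof (rule countable_subset)
  show "countable {t. \<not> isCont (fwd_jump T) t}"
    by (intro mono_ctble_discont monoI fwd_jump_mono)
  have "\<not> isCont (fwd_jump T) t" if "t \<in> T" "t < fwd_jump T t" for t
  proof
    assume "isCont (fwd_jump T) t"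
    then have "(fwd_jump T \<longlongrightarrow> fwd_jump T t) (at_left t)"
      by (simp add: isCont_def filterlim_at_split)
    moreover have "\<forall>\<^sub>F s in at_left t. fwd_jump T s \<le> t"
      using that by (auto simp: eventually_at_left_field intro!: exI[of _ "t - 1"] fwd_jump_le)
    ultimately have "fwd_jump T t \<le> t"
      by (intro tendsto_upperbound) auto
    then show False using that by simp
  qed
  then show "{t\<in>T. t < fwd_jump T t} \<subseteq> {t. \<not> isCont (fwd_jump T) t}" by blast
qed

lemma has_delta_derivative_right_dense:
  assumes "t \<in> X" "t \<in> ts_kappa T" "fwd_jump T t = t"
  shows "has_delta_derivative T X f D t \<longleftrightarrow> (f has_real_derivative D) (at t within X)"
proof -
  have "\<bar>f t - f s - D * (t - s)\<bar> = norm (f s - f t - D * (s - t))" for s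
    by (simp add: algebra_simps abs_if)
  then show ?thesis
    using assms
    by (simp add: has_delta_derivative_def has_field_derivative_def has_derivative_within_alt
        bounded_linear_mult_right abs_minus_commute)
qed

text \<open>Near \<open>t\<close> the factor \<open>\<bar>fwd_jump T t - s\<bar>\<close> stays
  between positive constants, so the defining estimate says that
  \<open>f u - f s - D * (u - s)\<close> tends to 0 as \<open>s\<close> tends to \<open>t\<close>,
  with \<open>u = fwd_jump T t\<close>. Taking \<open>s = t\<close> gives the difference quotient;
  the rest is continuity.\<close>

lemma has_delta_derivative_right_scattered:
  assumes "t \<in> X" "t \<in> ts_kappa T" "t < fwd_jump T t"
  shows "has_delta_derivative T X f D t \<longleftrightarrow>
    continuous (at t within X) f \<and> f (fwd_jump T t) - f t = D * (fwd_jump T t - t)"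
proof -
  define u where "u = fwd_jump T t"
  have u: "t < u" using assms by (simp add: u_def)
  show ?thesis
    unfolding u_def[symmetric]
  proof (intro iffI conjI)
    assume hd: "has_delta_derivative T X f D t"
    then have H: "\<exists>d>0. \<forall>s\<in>X. \<bar>s - t\<bar> < d \<longrightarrow> \<bar>f u - f s - D * (u - s)\<bar> \<le> e * \<bar>u - s\<bar>"
      if "e > 0" for e
      using that by (simp add: has_delta_derivative_def u_def)
    have "\<bar>f u - f t - D * (u - t)\<bar> \<le> 0"
    proof (rule field_le_epsilon)
      fix e :: real assume "e > 0"
      then show "\<bar>f u - f t - D * (u - t)\<bar> \<le> 0 + e"
        using H[of "e / (u - t)"] u assms(1) by auto
    qed
    then show eq: "f u - f t = D * (u - t)" by simp
    show "continuous (at t within X) f"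
      unfolding continuous_within_eps_delta dist_real_def
    proof (intro allI impI)
      fix e :: real assume e: "e > 0"
      \<comment> \<open>For \<open>\<bar>s - t\<bar> < u - t\<close> one has
        \<open>\<bar>u - s\<bar> \<le> 2 * (u - t)\<close>, so this choice makes the error at most
        \<open>e / 2\<close>.\<close>
      define e' where "e' = e / (2 * (2 * (u - t)))"
      have e': "e' > 0" using e u by (simp add: e'_def)
      obtain d where d: "d > 0"
        "\<And>s. s \<in> X \<Longrightarrow> \<bar>s - t\<bar> < d \<Longrightarrow> \<bar>f u - f s - D * (u - s)\<bar> \<le> e' * \<bar>u - s\<bar>"
        using H[OF e'] by blast
      \<comment> \<open>The last term of the minimum keeps \<open>D * (s - t)\<close> below
        \<open>e / 2\<close>; the summand 1 covers the case \<open>D = 0\<close>.\<close>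
      define d' where "d' = min d (min (u - t) (e / (2 * (\<bar>D\<bar> + 1))))"
      have d': "d' > 0" using d u e by (simp add: d'_def)
      show "\<exists>d>0. \<forall>s\<in>X. \<bar>s - t\<bar> < d \<longrightarrow> \<bar>f s - f t\<bar> < e"
      proof (intro exI[of _ d'] conjI ballI impI)
        fix s assume s: "s \<in> X" "\<bar>s - t\<bar> < d'"
        have "\<bar>f u - f s - D * (u - s)\<bar> \<le> e' * \<bar>u - s\<bar>"
          using d s by (simp add: d'_def)
        also have "\<dots> \<le> e' * (2 * (u - t))"
          using s e' u by (intro mult_left_mono) (auto simp: d'_def)
        also have "\<dots> = e / 2" using u by (simp add: e'_def field_simps)
        finally have 1: "\<bar>f u - f s - D * (u - s)\<bar> \<le> e / 2" .
        have "\<bar>D * (s - t)\<bar> \<le> (\<bar>D\<bar> + 1) * \<bar>s - t\<bar>"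
          by (simp add: abs_mult mult_right_mono)
        also have "\<dots> < (\<bar>D\<bar> + 1) * (e / (2 * (\<bar>D\<bar> + 1)))"
          using s by (intro mult_strict_left_mono) (auto simp: d'_def)
        also have "\<dots> = e / 2" by (simp add: field_simps add_nonneg_eq_0_iff)
        finally have 2: "\<bar>D * (s - t)\<bar> < e / 2" .
        have "f s - f t = D * (s - t) - (f u - f s - D * (u - s))"
          using eq by (simp add: algebra_simps)
        then show "\<bar>f s - f t\<bar> < e" using 1 2 by linarith
      qed (use d' in auto)
    qed
  next
    assume A: "continuous (at t within X) f \<and> f u - f t = D * (u - t)"
    have "\<exists>d>0. \<forall>s\<in>X. \<bar>s - t\<bar> < d \<longrightarrow> \<bar>f u - f s - D * (u - s)\<bar> \<le> e * \<bar>u - s\<bar>"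
      if e: "e > 0" for e
    proof -
      have "continuous (at t within X) (\<lambda>s. f s - D * s)"
        using A by (intro continuous_intros) auto
      moreover have "e * (u - t) / 2 > 0" using e u by simp
      ultimately obtain d where d: "d > 0"
        "\<And>s. s \<in> X \<Longrightarrow> \<bar>s - t\<bar> < d \<Longrightarrow> \<bar>(f s - D * s) - (f t - D * t)\<bar> < e * (u - t) / 2"
        unfolding continuous_within_eps_delta dist_real_def by blast
      show ?thesis
      \<comment> \<open>Within distance \<open>(u - t) / 2\<close> of \<open>t\<close>, the point
        \<open>s\<close> keeps at least that distance from \<open>u\<close>, so the fixed error from
        continuity is at most \<open>e * \<bar>u - s\<bar>\<close>.\<close>
      proof (intro exI[of _ "min d ((u - t) / 2)"] conjI ballI impI)
        fix s assume s: "s \<in> X" "\<bar>s - t\<bar> < min d ((u - t) / 2)"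
        have "f u - f s - D * (u - s) = - ((f s - D * s) - (f t - D * t))"
          using A by (simp add: algebra_simps)
        then have "\<bar>f u - f s - D * (u - s)\<bar> = \<bar>(f s - D * s) - (f t - D * t)\<bar>"
          by (simp only: abs_minus_cancel)
        also have "\<dots> \<le> e * ((u - t) / 2)"
          using d(2)[of s] s by simp
        also have "\<dots> \<le> e * \<bar>u - s\<bar>"
        proof (rule mult_left_mono)
          have "\<bar>s - t\<bar> < (u - t) / 2" using s by simp
          then have "s - t \<le> (u - t) / 2" by linarith
          then have "(u - t) / 2 \<le> u - s" by (simp add: field_simps)
          then show "(u - t) / 2 \<le> \<bar>u - s\<bar>" by linarith
        qed (use e in simp)
        finally show "\<bar>f u - f s - D * (u - s)\<bar> \<le> e * \<bar>u - s\<bar>" .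
      qed (use d u in auto)
    qed
    then show "has_delta_derivative T X f D t"
      using assms by (simp add: has_delta_derivative_def u_def)
  qed
qed

text \<open>Lets the rules of calculus be read off from ordinary derivatives at right-dense points
  and from difference quotients at right-scattered ones.\<close>

lemma has_delta_derivative_cases:
  "has_delta_derivative T X f D t \<longleftrightarrow> t \<in> X \<and> t \<in> ts_kappa T \<and>
    (if fwd_jump T t = t then (f has_real_derivative D) (at t within X)
     else continuous (at t within X) f \<and> f (fwd_jump T t) - f t = D * (fwd_jump T t - t))"
  using has_delta_derivative_right_dense[of t X T f D]
    has_delta_derivative_right_scattered[of t X T f D] fwd_jump_ge[of t T]
  by (auto simp: has_delta_derivative_def[of T X f D t])

lemma has_delta_derivative_continuous:
  "has_delta_derivative T X f D t \<Longrightarrow> continuous (at t within X) f"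
  by (auto simp: has_delta_derivative_cases split: if_splits dest: DERIV_continuous)

lemma has_delta_derivative_add:
  assumes "has_delta_derivative T X f D t" "has_delta_derivative T X g E t"
  shows "has_delta_derivative T X (\<lambda>s. f s + g s) (D + E) t"
  using assms
  by (auto simp: has_delta_derivative_cases algebra_simps split: if_splits
      intro!: DERIV_add continuous_add)

lemma has_delta_derivative_cmult:
  assumes "has_delta_derivative T X f D t"
  shows "has_delta_derivative T X (\<lambda>s. c * f s) (c * D) t"
proof -
  have "c * f u - c * f t = c * D * (u - t)" if "f u - f t = D * (u - t)" for u
    using that by (simp flip: right_diff_distrib)
  then show ?thesis
    using assms
    by (auto simp: has_delta_derivative_cases split: if_splits
        intro!: DERIV_cmult continuous_mult continuous_const)
qed

lemma has_delta_derivative_diff: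
  assumes "has_delta_derivative T X f D t" "has_delta_derivative T X g E t"
  shows "has_delta_derivative T X (\<lambda>s. f s - g s) (D - E) t"
  using has_delta_derivative_add[OF assms(1) has_delta_derivative_cmult[OF assms(2), of "-1"]]
  by simp

lemma has_delta_derivative_diff_const:
  assumes "has_delta_derivative T X f D t"
  shows "has_delta_derivative T X (\<lambda>s. f s - c) D t"
  using assms
  by (auto simp: has_delta_derivative_cases split: if_splits
      intro!: derivative_eq_intros continuous_intros)

text \<open>The product rule is asymmetric at a jump. The forward value is put on the second factor
  because integration by parts has to produce \<open>\<nu>\<close> times \<open>f\<close> composed
  with \<sigma>.\<close>

lemma has_delta_derivative_mult:
  assumes "has_delta_derivative T X f D t" "has_delta_derivative T X g E t"
  shows "has_delta_derivative T X (\<lambda>s. f s * g s) (f t * E + D * g (fwd_jump T t)) t"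
proof (cases "fwd_jump T t = t")
  case True
  then show ?thesis
    using assms DERIV_mult[of f D t X g E]
    by (auto simp: has_delta_derivative_cases algebra_simps)
next
  case False
  let ?u = "fwd_jump T t"
  have *: "f ?u - f t = D * (?u - t)" "g ?u - g t = E * (?u - t)"
    using False assms by (auto simp: has_delta_derivative_cases)
  have "f ?u * g ?u - f t * g t = f t * (g ?u - g t) + (f ?u - f t) * g ?u"
    by (simp add: algebra_simps)
  also have "\<dots> = (f t * E + D * g ?u) * (?u - t)"
    unfolding * by (simp add: algebra_simps)
  finally show ?thesis
    using False assms by (auto simp: has_delta_derivative_cases intro!: continuous_mult)
qed

section \<open>The mean value inequality on an interval of a time scale\<close>

locale time_scale_interval =
  fixes T :: "real set" and a b :: real
  assumes closed_T: "closed T" and a_in: "a \<in> T" and b_in: "b \<in> T" and a_less_b: "a < b"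
begin

abbreviation "X \<equiv> T \<inter> {a..b}"

lemma kappa: "t \<in> T \<Longrightarrow> t < b \<Longrightarrow> t \<in> ts_kappa T"
  using b_in by (force simp: ts_kappa_def)

lemma fwd_jump_in_X: "t \<in> T \<Longrightarrow> a \<le> t \<Longrightarrow> t < b \<Longrightarrow> fwd_jump T t \<in> X"
  using fwd_jump_in[OF closed_T b_in] fwd_jump_le[OF _ b_in] fwd_jump_ge[of t T] by force

lemma compact_X: "compact X"
  using closed_T by (simp add: closed_Int_compact)

text \<open>A point \<open>u\<close> where the bound first fails is either right-dense, where the derivative at \<open>u\<close>
  rules out failures just after \<open>u\<close>, or left-dense, where continuity does, or the forward jump of
  its predecessor.\<close>

lemma delta_nonneg_imp_le_aux:
  assumes cd: "c \<in> X" "d \<in> X" "c \<le> d"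
    and cont: "continuous_on X H"
    and der: "\<And>t. t \<in> T \<Longrightarrow> c \<le> t \<Longrightarrow> t < d \<Longrightarrow> has_delta_derivative T X H (h t) t"
    and nonneg: "\<And>t. t \<in> T \<Longrightarrow> c \<le> t \<Longrightarrow> t < d \<Longrightarrow> 0 \<le> h t"
    and e: "0 < e"
  shows "H c - e * (d - c) \<le> H d"
proof (rule ccontr)
  assume contra: "\<not> H c - e * (d - c) \<le> H d"
  \<comment> \<open>\<open>B\<close> collects the points where the bound fails; the slack
    \<open>e * (t - c)\<close> turns the weak sign condition on \<open>h\<close> into something that
    survives small errors.\<close>
  define B where "B = {t\<in>T. c \<le> t \<and> t \<le> d \<and> H t < H c - e * (t - c)}"
  define u where "u = Inf B"
  have dB: "d \<in> B" using contra cd by (simp add: B_def)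
  have bdd: "bdd_below B" by (auto simp: B_def intro: bdd_belowI[of _ c])
  have BX: "B \<subseteq> T \<inter> {c..d}" by (auto simp: B_def)
  have "u \<in> closure B" unfolding u_def using dB bdd by (intro closure_contains_Inf) auto
  moreover have "closure B \<subseteq> T \<inter> {c..d}"
    using BX closed_T by (intro closure_minimal) auto
  ultimately have u: "u \<in> T" "c \<le> u" "u \<le> d" by auto
  have lower: "s \<notin> B" if "s < u" for s
    using that cInf_lower[OF _ bdd] by (force simp: u_def)
  have uX: "u \<in> X" using u cd by auto
  show False
  proof (cases "u \<in> B")
    case False
    have near: "\<exists>s\<in>B. u < s \<and> s < y" if "u < y" for y
    proof -
      have "\<exists>s\<in>B. s < y" using that dB bdd by (intro cInf_lessD) (auto simp: u_def)
      then show ?thesis using lower False by (metis linorder_neqE_linordered_idom)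
    qed
    have "u < d" using False dB u by (cases "u = d") auto
    have dense: "fwd_jump T u = u"
    proof (rule ccontr)
      assume "fwd_jump T u \<noteq> u"
      then have "u < fwd_jump T u" using fwd_jump_ge[of u T] by simp
      then obtain s where "s \<in> B" "u < s" "s < fwd_jump T u" using near by blast
      then show False using fwd_jump_gap[of s T u] by (auto simp: B_def)
    qed
    \<comment> \<open>The error \<open>e * \<bar>u - s\<bar>\<close> in the derivative at
      \<open>u\<close> is exactly what the slack gains between \<open>u\<close> and
      \<open>s\<close>, so the bound at \<open>u\<close> carries over to nearby
      \<open>s > u\<close>.\<close>
    obtain \<delta> where \<delta>: "\<delta> > 0"
      "\<And>s. s \<in> X \<Longrightarrow> \<bar>s - u\<bar> < \<delta> \<Longrightarrow> \<bar>H u - H s - h u * (u - s)\<bar> \<le> e * \<bar>u - s\<bar>"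
      using der[OF u(1,2) \<open>u < d\<close>] e dense unfolding has_delta_derivative_def by auto
    obtain s where s: "s \<in> B" "u < s" "s < u + \<delta>" using near[of "u + \<delta>"] \<delta> by auto
    have "\<bar>H u - H s - h u * (u - s)\<bar> \<le> e * (s - u)"
      using \<delta>(2)[of s] s subsetD[OF BX s(1)] cd by auto
    moreover have "h u * (s - u) \<ge> 0" using nonneg[OF u(1,2) \<open>u < d\<close>] s by simp
    moreover have "H u \<ge> H c - e * (u - c)" using False u by (auto simp: B_def)
    moreover have "H s < H c - e * (s - c)" using s by (simp add: B_def)
    ultimately show False by (simp add: algebra_simps)
  next
    case True
    have "u \<noteq> c" using True by (auto simp: B_def)
    then have cu: "c < u" using u by simp
    have bw: "bwd_jump T u = Sup {s\<in>T. s < u}" using cu cd by (auto simp: bwd_jump_def)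
    define p where "p = bwd_jump T u"
    have ex: "c \<in> {s\<in>T. s < u}" using cu cd by auto
    have bda: "bdd_above {s\<in>T. s < u}" by (auto intro: bdd_aboveI[of _ u])
    have cp: "c \<le> p" unfolding p_def bw using ex bda by (rule cSup_upper)
    have pu: "p \<le> u" unfolding p_def bw using ex by (intro cSup_least) auto
    have "p \<in> closure {s\<in>T. s < u}"
      unfolding p_def bw using ex bda by (intro closure_contains_Sup) auto
    then have pT: "p \<in> T"
      using closure_minimal[of "{s\<in>T. s < u}" T] closed_T by auto
    have not_B: "H s \<ge> H c - e * (s - c)" if "s \<in> T" "c \<le> s" "s < u" for s
      using lower[of s] that u by (auto simp: B_def)
    show False
    proof (cases "p = u")
      case False
      then have "p < u" using pu by simp
      then have pd: "p < d" using u by simp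
      have "fwd_jump T p = u"
      proof (rule antisym)
        show "fwd_jump T p \<le> u" using \<open>p < u\<close> u by (intro fwd_jump_le) auto
        have "s \<le> p" if "s \<in> T" "s < u" for s
          unfolding p_def bw using that bda by (intro cSup_upper) auto
        then show "u \<le> fwd_jump T p"
          using u \<open>p < u\<close> by (force simp: fwd_jump_def intro!: cInf_greatest)
      qed
      then have "H u - H p = h p * (u - p)"
        using der[OF pT cp pd] \<open>p < u\<close> by (simp add: has_delta_derivative_cases split: if_splits)
      moreover have "h p * (u - p) \<ge> 0" using nonneg[OF pT cp pd] pu by simp
      moreover have "e * (u - c) \<ge> e * (p - c)" using e pu by (intro mult_left_mono) auto
      ultimately show False
        using not_B[OF pT cp \<open>p < u\<close>] True by (auto simp: B_def)
    next
      case True': True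
      \<comment> \<open>Negativity of \<open>g\<close> means failure of the bound. By continuity
        \<open>g\<close> would be negative at points of \<open>T\<close> just before
        \<open>u\<close>, where the bound is known to hold.\<close>
      define g where "g s = H s - (H c - e * (s - c))" for s
      have "continuous_on X g" unfolding g_def using cont by (intro continuous_intros)
      then have "continuous (at u within X) g" using uX by (simp add: continuous_on_eq_continuous_within)
      moreover have "g u < 0" using True by (simp add: B_def g_def)
      ultimately obtain \<delta> where \<delta>: "\<delta> > 0" "\<And>s. s \<in> X \<Longrightarrow> \<bar>s - u\<bar> < \<delta> \<Longrightarrow> \<bar>g s - g u\<bar> < - g u"
        unfolding continuous_within_eps_delta dist_real_def by (metis neg_0_less_iff_less)
      have "max c (u - \<delta>) < p" using True' cu \<delta> by simp
      then obtain s where s: "s \<in> T" "s < u" "max c (u - \<delta>) < s"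
        unfolding p_def bw using less_cSup_iff[of "{s\<in>T. s < u}"] ex bda by blast
      then have "g s < 0" using \<delta>(2)[of s] cd u by (auto simp: abs_less_iff)
      then show False using not_B[of s] s by (simp add: g_def)
    qed
  qed
qed

text \<open>At a right-dense left end point \<open>c\<close> no sign condition is needed: \<open>sup_points\<close> leaves it out.\<close>

lemma delta_nonneg_imp_le:
  assumes cd: "c \<in> X" "d \<in> X" "c \<le> d"
    and cont: "continuous_on X H"
    and der: "\<And>t. t \<in> T \<Longrightarrow> c \<le> t \<Longrightarrow> t < d \<Longrightarrow> has_delta_derivative T X H (h t) t"
    and nonneg: "\<And>t. t \<in> T \<Longrightarrow> c \<le> t \<Longrightarrow> t < d \<Longrightarrow> t \<noteq> c \<or> c < fwd_jump T c \<Longrightarrow> 0 \<le> h t"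
  shows "H c \<le> H d"
proof -
  have le: "H s \<le> H d" if s: "s \<in> T" "c \<le> s" "s \<le> d" "s \<noteq> c \<or> c < fwd_jump T c" for s
  proof (rule field_le_epsilon)
    fix e :: real assume e: "e > 0"
    \<comment> \<open>The summand 1 keeps the denominator positive when
      \<open>s = d\<close>.\<close>
    define e' where "e' = e / (d - s + 1)"
    have e': "e' > 0" using e s by (simp add: e'_def)
    have "H s - e' * (d - s) \<le> H d"
      using s cd e' by (intro delta_nonneg_imp_le_aux[where h = h] cont der nonneg) auto
    moreover have "e' * (d - s) \<le> e' * (d - s + 1)" using e' by (intro mult_left_mono) auto
    moreover have "e' * (d - s + 1) = e" using s by (simp add: e'_def)
    ultimately show "H s \<le> H d + e" by linarith
  qed
  show ?thesis
  proof (cases "c < fwd_jump T c \<or> c = d")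
    case True
    then show ?thesis using le[of c] cd by auto
  next
    case False
    then have c: "fwd_jump T c = c" "c < d" using fwd_jump_ge[of c T] cd by auto
    show ?thesis
    proof (rule field_le_epsilon)
      fix e :: real assume e: "e > 0"
      have "continuous (at c within X) H"
        using cont cd by (simp add: continuous_on_eq_continuous_within)
      then obtain \<delta> where \<delta>: "\<delta> > 0" "\<And>s. s \<in> X \<Longrightarrow> \<bar>s - c\<bar> < \<delta> \<Longrightarrow> \<bar>H s - H c\<bar> < e"
        using e unfolding continuous_within_eps_delta dist_real_def by blast
      \<comment> \<open>Since \<open>c\<close> is right-dense, \<open>T\<close> has points
        \<open>s > c\<close> arbitrarily close to \<open>c\<close>. There
        \<open>H s \<le> H d\<close> is known, and continuity of \<open>H\<close> at
        \<open>c\<close> transfers it up to \<open>e\<close>.\<close>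
      have "fwd_jump T c < min d (c + \<delta>)" using c \<delta> by simp
      moreover have "d \<in> {s\<in>T. c < s}" using c cd by auto
      ultimately have "\<exists>s\<in>{s\<in>T. c < s}. s < min d (c + \<delta>)"
        by (intro cInf_lessD) (auto simp: fwd_jump_def split: if_splits)
      then obtain s where "s \<in> T" "c < s" "s < min d (c + \<delta>)" by blast
      then show "H c \<le> H d + e" using le[of s] \<delta>(2)[of s] cd by auto
    qed
  qed
qed

text \<open>Both \<open>P - F\<close> and \<open>P + F\<close> have a nonnegative derivative
  wherever the bound is assumed, so monotonicity applies to each of them.\<close>

lemma delta_mean_value_inequality:
  assumes cd: "c \<in> X" "d \<in> X" "c \<le> d"
    and cont: "continuous_on X F" "continuous_on X P"
    and derF: "\<And>t. t \<in> T \<Longrightarrow> c \<le> t \<Longrightarrow> t < d \<Longrightarrow> has_delta_derivative T X F (F' t) t"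
    and derP: "\<And>t. t \<in> T \<Longrightarrow> c \<le> t \<Longrightarrow> t < d \<Longrightarrow> has_delta_derivative T X P (P' t) t"
    and le: "\<And>t. t \<in> T \<Longrightarrow> c \<le> t \<Longrightarrow> t < d \<Longrightarrow> t \<noteq> c \<or> c < fwd_jump T c \<Longrightarrow> \<bar>F' t\<bar> \<le> P' t"
  shows "\<bar>F d - F c\<bar> \<le> P d - P c"
proof -
  have "P c - F c \<le> P d - F d"
    using le by (intro delta_nonneg_imp_le[where H = "\<lambda>s. P s - F s" and h = "\<lambda>t. P' t - F' t"]
        cd has_delta_derivative_diff derF derP continuous_intros cont) (auto simp: abs_le_iff)
  moreover have "P c + F c \<le> P d + F d"
    using le by (intro delta_nonneg_imp_le[where H = "\<lambda>s. P s + F s" and h = "\<lambda>t. P' t + F' t"]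
        cd has_delta_derivative_add derF derP continuous_intros cont) (force simp: abs_le_iff)+
  ultimately show ?thesis by linarith
qed

section \<open>Bounded functions continuous at right-dense points, and their measurability\<close>

abbreviation "Y \<equiv> T \<inter> {a..<b}"

text \<open>Products and integrals of rd-continuous functions and of \<open>f \<circ> \<sigma>\<close> are handled through this
  weaker notion: left limits are replaced by boundedness.\<close>

definition rd_regular :: "(real \<Rightarrow> real) \<Rightarrow> bool" where
  "rd_regular g \<longleftrightarrow> (\<exists>C. \<forall>t\<in>Y. \<bar>g t\<bar> \<le> C) \<and>
    (\<forall>t\<in>Y. fwd_jump T t = t \<longrightarrow> continuous (at t within Y) g)"

lemma rd_regular_bound:
  assumes "rd_regular g" obtains C where "0 \<le> C" "\<And>t. t \<in> Y \<Longrightarrow> \<bar>g t\<bar> \<le> C"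
proof -
  obtain C where C: "\<And>t. t \<in> Y \<Longrightarrow> \<bar>g t\<bar> \<le> C" using assms unfolding rd_regular_def by blast
  moreover have "a \<in> Y" using a_in a_less_b by simp
  ultimately show ?thesis using that[of C] by (metis abs_ge_zero order_trans)
qed

lemma continuous_on_X_bound:
  assumes "continuous_on X (h :: real \<Rightarrow> real)" shows "\<exists>C. \<forall>t\<in>X. \<bar>h t\<bar> \<le> C"
  using compact_imp_bounded[OF compact_continuous_image[OF assms compact_X]]
  by (auto simp: bounded_iff)

lemma continuous_within_Y: "continuous (at t within X) g \<Longrightarrow> continuous (at t within Y) g"
  by (rule continuous_within_subset) auto

lemma rd_regular_continuous_on:
  assumes "continuous_on X h" shows "rd_regular h"
proof -
  have "continuous (at t within Y) h" if "t \<in> Y" for t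
    using assms that by (intro continuous_within_Y) (auto simp: continuous_on_eq_continuous_within)
  then show ?thesis using continuous_on_X_bound[OF assms] by (fastforce simp: rd_regular_def)
qed

text \<open>At a right-dense \<open>t\<close> the jump operator is continuous: from the right
  always, and from the left because \<open>s \<le> fwd_jump T s \<le> t\<close> for
  \<open>s < t\<close>. Boundedness comes from compactness of \<open>X\<close>, which contains the
  jumps of all points of \<open>Y\<close>.\<close>

lemma rd_regular_fwd_jump:
  assumes h: "continuous_on X h" shows "rd_regular (\<lambda>t. h (fwd_jump T t))"
  unfolding rd_regular_def
proof (intro conjI ballI impI)
  show "\<exists>C. \<forall>t\<in>Y. \<bar>h (fwd_jump T t)\<bar> \<le> C"
    using continuous_on_X_bound[OF h] fwd_jump_in_X by fastforce
  fix t assume t: "t \<in> Y" "fwd_jump T t = t"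
  have "(fwd_jump T \<longlongrightarrow> fwd_jump T t) (at_right t)"
    using fwd_jump_right_continuous[of t T] by (simp add: continuous_within)
  moreover have "((\<lambda>s. fwd_jump T s) \<longlongrightarrow> t) (at_left t)"
  proof (rule tendsto_sandwich[where f = "\<lambda>s. s" and h = "\<lambda>_. t"])
    show "\<forall>\<^sub>F s in at_left t. fwd_jump T s \<le> t"
      using t by (auto simp: eventually_at_left_field intro!: exI[of _ "t - 1"] fwd_jump_le)
  qed (auto intro: fwd_jump_ge always_eventually tendsto_intros)
  ultimately have "isCont (fwd_jump T) t"
    using t by (simp add: isCont_def filterlim_at_split)
  then have cont: "continuous (at t within Y) (fwd_jump T)"
    by (rule continuous_at_imp_continuous_at_within)
  have "continuous (at (fwd_jump T t) within fwd_jump T ` Y) h"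
  proof (rule continuous_within_subset)
    show "continuous (at (fwd_jump T t) within X) h"
      using h t by (auto simp: continuous_on_eq_continuous_within)
    show "fwd_jump T ` Y \<subseteq> X" using fwd_jump_in_X by auto
  qed
  then show "continuous (at t within Y) (\<lambda>t. h (fwd_jump T t))"
    using continuous_within_compose[OF cont] by (simp add: o_def)
qed

lemma rd_regular_mult:
  assumes "rd_regular g" "rd_regular h" shows "rd_regular (\<lambda>t. g t * h t)"
proof -
  obtain C where C: "0 \<le> C" "\<And>t. t \<in> Y \<Longrightarrow> \<bar>g t\<bar> \<le> C" using rd_regular_bound[OF assms(1)] by metis
  obtain D where D: "0 \<le> D" "\<And>t. t \<in> Y \<Longrightarrow> \<bar>h t\<bar> \<le> D" using rd_regular_bound[OF assms(2)] by metis
  have "\<bar>g t * h t\<bar> \<le> C * D" if "t \<in> Y" for t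
    unfolding abs_mult using that C D by (intro mult_mono) auto
  then have "\<exists>C. \<forall>t\<in>Y. \<bar>g t * h t\<bar> \<le> C" by blast
  then show ?thesis using assms by (simp add: rd_regular_def continuous_mult)
qed

lemma rd_regular_abs: "rd_regular g \<Longrightarrow> rd_regular (\<lambda>t. \<bar>g t\<bar>)"
  by (auto simp: rd_regular_def intro!: continuous_rabs)

lemma rd_regular_const: "rd_regular (\<lambda>_. c)"
  by (auto simp: rd_regular_def)

text \<open>Only boundedness takes work. One-sided limits, or gaps in \<open>T\<close>, bound
  \<open>g\<close> near each point of \<open>X\<close>, and compactness reduces these local bounds
  to finitely many.\<close>

lemma rd_regular_rd_continuous:
  assumes rd: "rd_continuous_on T X g" shows "rd_regular g"
  unfolding rd_regular_def
proof (intro conjI ballI impI)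
  fix t assume "t \<in> Y" "fwd_jump T t = t"
  then show "continuous (at t within Y) g"
    using rd by (intro continuous_within_Y) (auto simp: rd_continuous_on_def)
next
  have evb: "\<exists>C. \<forall>\<^sub>F s in F. \<bar>g s\<bar> \<le> C" if "(g \<longlongrightarrow> l) F" for l F
  proof -
    have "\<forall>\<^sub>F s in F. dist (g s) l < 1" using that by (rule tendstoD) simp
    then have "\<forall>\<^sub>F s in F. \<bar>g s\<bar> \<le> \<bar>l\<bar> + 1"
      by eventually_elim (auto simp: dist_real_def)
    then show ?thesis ..
  qed
  have "\<exists>\<delta> C. \<delta> > 0 \<and> (\<forall>s\<in>X. \<bar>s - t\<bar> < \<delta> \<longrightarrow> \<bar>g s\<bar> \<le> C)" if t: "t \<in> X" for t
  proof -
    have "\<exists>C. \<forall>\<^sub>F s in at t within X \<inter> {t<..}. \<bar>g s\<bar> \<le> C"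
    proof (cases "fwd_jump T t = t")
      case True
      then have "(g \<longlongrightarrow> g t) (at t within X)"
        using rd t by (simp add: rd_continuous_on_def continuous_within)
      then show ?thesis by (rule evb[OF tendsto_within_subset]) auto
    next
      case False
      then have "t < fwd_jump T t" using fwd_jump_ge[of t T] by simp
      \<comment> \<open>No point of \<open>T\<close> lies strictly between \<open>t\<close> and
        \<open>fwd_jump T t\<close>, so the bound 0 holds vacuously near \<open>t\<close> on this
        side.\<close>
      then have "\<forall>\<^sub>F s in at t within X \<inter> {t<..}. \<bar>g s\<bar> \<le> 0"
        unfolding eventually_at
        by (intro exI[of _ "fwd_jump T t - t"]) (auto simp: dist_real_def dest: fwd_jump_gap)
      then show ?thesis ..
    qed
    moreover have "\<exists>C. \<forall>\<^sub>F s in at t within X \<inter> {..<t}. \<bar>g s\<bar> \<le> C"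
    proof (cases "bwd_jump T t = t")
      case True
      then show ?thesis using rd t evb by (auto simp: rd_continuous_on_def)
    next
      case False
      have up: "s \<le> bwd_jump T t" if "s \<in> T" "s < t" for s
        using that cSup_upper[of s "{s\<in>T. s < t}"] bdd_aboveI[of "{s\<in>T. s < t}" t]
        by (auto simp: bwd_jump_def)
      have "bwd_jump T t < t"
        using False cSup_least[of "{s\<in>T. s < t}" t] by (force simp: bwd_jump_def split: if_splits)
      then have "\<forall>\<^sub>F s in at t within X \<inter> {..<t}. \<bar>g s\<bar> \<le> 0"
        unfolding eventually_at
        by (intro exI[of _ "t - bwd_jump T t"]) (auto simp: dist_real_def dest: up)
      then show ?thesis ..
    qed
    ultimately obtain C1 C2 where
      "\<forall>\<^sub>F s in at t within X \<inter> {t<..}. \<bar>g s\<bar> \<le> C1"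
      "\<forall>\<^sub>F s in at t within X \<inter> {..<t}. \<bar>g s\<bar> \<le> C2" by blast
    then obtain d1 d2 where d: "d1 > 0" "d2 > 0"
      "\<And>s. s \<in> X \<Longrightarrow> t < s \<Longrightarrow> \<bar>s - t\<bar> < d1 \<Longrightarrow> \<bar>g s\<bar> \<le> C1"
      "\<And>s. s \<in> X \<Longrightarrow> s < t \<Longrightarrow> \<bar>s - t\<bar> < d2 \<Longrightarrow> \<bar>g s\<bar> \<le> C2"
      unfolding eventually_at by (fastforce simp: dist_real_def)
    have "\<bar>g s\<bar> \<le> max \<bar>g t\<bar> (max C1 C2)" if "s \<in> X" "\<bar>s - t\<bar> < min d1 d2" for s
      using d(3)[of s] d(4)[of s] that by (cases s t rule: linorder_cases) (auto simp: le_max_iff_disj)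
    then show ?thesis
      using d by (intro exI[of _ "min d1 d2"] exI[of _ "max \<bar>g t\<bar> (max C1 C2)"]) simp
  qed
  then obtain \<delta> C where \<delta>: "\<And>t. t \<in> X \<Longrightarrow> \<delta> t > 0"
    "\<And>t s. t \<in> X \<Longrightarrow> s \<in> X \<Longrightarrow> \<bar>s - t\<bar> < \<delta> t \<Longrightarrow> \<bar>g s\<bar> \<le> C t" by metis
  have "X \<subseteq> (\<Union>t\<in>X. ball t (\<delta> t))" using \<delta> by force
  then obtain K where K: "K \<subseteq> X" "finite K" "X \<subseteq> (\<Union>t\<in>K. ball t (\<delta> t))"
    using compactE_image[OF compact_X, of X "\<lambda>t. ball t (\<delta> t)"] by auto
  have "\<bar>g s\<bar> \<le> Max (C ` K)" if "s \<in> Y" for s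
  proof -
    have sX: "s \<in> X" using that by auto
    then obtain t where t: "t \<in> K" "\<bar>s - t\<bar> < \<delta> t"
      using K by (auto simp: dist_real_def abs_minus_commute)
    then have "\<bar>g s\<bar> \<le> C t" using \<delta>(2)[of t s] K sX by blast
    then show ?thesis using t K by (meson Max_ge finite_imageI imageI order_trans)
  qed
  then show "\<exists>C. \<forall>t\<in>Y. \<bar>g t\<bar> \<le> C" by blast
qed

text \<open>The right-scattered points of \<open>Y\<close> form a countable set and are treated as
  single points. On the remaining right-dense points \<open>g\<close> is continuous, and outside
  \<open>Y\<close> the function is 0.\<close>

lemma rd_regular_measurable:
  assumes g: "rd_regular g" shows "set_borel_measurable (delta_measure T) Y g"
  unfolding set_borel_measurable_def
proof -
  let ?D = "{t\<in>T. t < fwd_jump T t}"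
  let ?F = "\<lambda>x. indicat_real Y x *\<^sub>R g x"
  have cD: "countable (?D \<inter> Y)" using countable_right_scattered by (rule countable_subset[rotated]) auto
  have sets_D: "?D \<inter> Y \<in> sets borel" "Y \<in> sets borel"
    using cD closed_T by (auto intro: sets.countable)
  have "?F \<in> borel_measurable borel"
  proof (rule measurable_piecewise_restrict[where C = "{-Y, Y - ?D} \<union> (\<lambda>d. {d}) ` (?D \<inter> Y)"])
    show "countable ({-Y, Y - ?D} \<union> (\<lambda>d. {d}) ` (?D \<inter> Y))" using cD by auto
    have "Y - ?D \<inter> Y \<in> sets borel" using sets_D by (intro sets.Diff)
    moreover have "Y - ?D \<inter> Y = Y - ?D" by auto
    ultimately have "Y - ?D \<in> sets borel" by (simp only:)
    moreover have "- Y \<in> sets borel" using sets_D(2) by (rule borel_comp)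
    ultimately show "\<Omega> \<inter> space borel \<in> sets borel"
      if "\<Omega> \<in> {-Y, Y - ?D} \<union> (\<lambda>d. {d}) ` (?D \<inter> Y)" for \<Omega>
      using that sets_D by (auto simp del: Compl_Int)
    show "space borel \<subseteq> \<Union> ({-Y, Y - ?D} \<union> (\<lambda>d. {d}) ` (?D \<inter> Y))" by auto
    fix \<Omega> assume "\<Omega> \<in> {-Y, Y - ?D} \<union> (\<lambda>d. {d}) ` (?D \<inter> Y)"
    then consider "\<Omega> = -Y" | "\<Omega> = Y - ?D" | d where "\<Omega> = {d}" by blast
    then show "?F \<in> borel_measurable (restrict_space borel \<Omega>)"
    proof cases
      case 1
      have "(\<lambda>_. 0 :: real) \<in> borel_measurable (restrict_space borel \<Omega>)" by simp
      then show ?thesis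
        by (rule measurable_cong[THEN iffD1, rotated]) (use 1 in \<open>auto simp: space_restrict_space\<close>)
    next
      case 2
      have "continuous_on (Y - ?D) g"
        unfolding continuous_on_eq_continuous_within
      proof
        fix t assume t: "t \<in> Y - ?D"
        then have "fwd_jump T t = t" using fwd_jump_ge[of t T] by (auto simp: not_less)
        then have "continuous (at t within Y) g" using g t by (simp add: rd_regular_def)
        then show "continuous (at t within Y - ?D) g" by (rule continuous_within_subset) auto
      qed
      then have "g \<in> borel_measurable (restrict_space borel \<Omega>)"
        unfolding 2 by (rule borel_measurable_continuous_on_restrict)
      then show ?thesis
        by (rule measurable_cong[THEN iffD1, rotated]) (use 2 in \<open>auto simp: space_restrict_space\<close>)
    next
      case 3
      have "(\<lambda>_. ?F d) \<in> borel_measurable (restrict_space borel \<Omega>)" by simp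
      then show ?thesis
        by (rule measurable_cong[THEN iffD1, rotated]) (use 3 in \<open>auto simp: space_restrict_space\<close>)
    qed
  qed
  then show "?F \<in> borel_measurable (delta_measure T)"
    by (simp add: measurable_cong_sets[OF sets_delta_measure refl])
qed

section \<open>The delta integral and the fundamental theorem\<close>

lemma measure_Ico:
  assumes "c \<in> X" "d \<in> X" "c \<le> d"
  shows "T \<inter> {c..<d} \<in> sets (delta_measure T)"
    "emeasure (delta_measure T) (T \<inter> {c..<d}) < \<infinity>"
    "measure (delta_measure T) (T \<inter> {c..<d}) = d - c"
  using delta_measure_Ico[of T c d] assms closed_T by (auto simp: measure_def)

lemma rd_regular_set_integrable:
  assumes g: "rd_regular g" and cd: "c \<in> X" "d \<in> X" "c \<le> d"
  shows "set_integrable (delta_measure T) (T \<inter> {c..<d}) g"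
proof -
  obtain C where C: "\<And>t. t \<in> Y \<Longrightarrow> \<bar>g t\<bar> \<le> C" using rd_regular_bound[OF g] by metis
  let ?A = "T \<inter> {c..<d}"
  have sub: "?A \<subseteq> Y" using cd by auto
  have "integrable (delta_measure T) (\<lambda>x. indicator ?A x *\<^sub>R (indicator Y x *\<^sub>R g x))"
  proof (rule integrableI_bounded_set_indicator)
    show "(\<lambda>x. indicator Y x *\<^sub>R g x) \<in> borel_measurable (delta_measure T)"
      using rd_regular_measurable[OF g] by (simp add: set_borel_measurable_def)
    show "AE x in delta_measure T. x \<in> ?A \<longrightarrow> norm (indicator Y x *\<^sub>R g x) \<le> C"
    proof (intro AE_I2 impI)
      fix x assume "x \<in> ?A"
      then have "x \<in> Y" using sub by blast
      then show "norm (indicator Y x *\<^sub>R g x) \<le> C" using C by simp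
    qed
  qed (use measure_Ico[OF cd] in auto)
  moreover have "indicator ?A x *\<^sub>R (indicator Y x *\<^sub>R g x) = indicator ?A x *\<^sub>R g x" for x
    using sub by (auto simp: indicator_def)
  ultimately show ?thesis by (simp only: set_integrable_def)
qed

lemma delta_integral_split:
  assumes "set_integrable (delta_measure T) (T \<inter> {c..<d}) g"
    "set_integrable (delta_measure T) (T \<inter> {d..<e}) g" "c \<le> d" "d \<le> e"
  shows "delta_integral T c e g = delta_integral T c d g + delta_integral T d e g"
proof -
  have "T \<inter> {c..<e} = (T \<inter> {c..<d}) \<union> (T \<inter> {d..<e})" using assms by auto
  then show ?thesis
    unfolding delta_integral_def using assms by (simp only:) (rule set_integral_Un; auto)
qed

text \<open>Squeezes \<open>g\<close> between the constants \<open>k - e\<close> and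
  \<open>k + e\<close>. The case \<open>k = 0\<close> gives a Lipschitz bound,
  \<open>k = g t\<close> the derivative of the indefinite integral, and \<open>e = 0\<close> the
  exact value over a single atom.\<close>

lemma delta_integral_approx:
  assumes g: "rd_regular g" and cd: "c \<in> X" "d \<in> X" "c \<le> d"
    and le: "\<And>t. t \<in> T \<Longrightarrow> c \<le> t \<Longrightarrow> t < d \<Longrightarrow> \<bar>g t - k\<bar> \<le> e"
  shows "\<bar>delta_integral T c d g - k * (d - c)\<bar> \<le> e * (d - c)"
proof -
  have const: "delta_integral T c d (\<lambda>_. r) = r * (d - c)" for r
    using measure_Ico[OF cd] by (simp add: delta_integral_def set_lebesgue_integral_def sets_delta_measure)
  note int = rd_regular_set_integrable[OF _ cd]
  have "delta_integral T c d g \<le> delta_integral T c d (\<lambda>_. k + e)"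
    unfolding delta_integral_def
    using le by (intro set_integral_mono int g rd_regular_const) (force simp: abs_le_iff)
  moreover have "delta_integral T c d (\<lambda>_. k - e) \<le> delta_integral T c d g"
    unfolding delta_integral_def
    using le by (intro set_integral_mono int g rd_regular_const) (force simp: abs_le_iff)
  ultimately show ?thesis by (simp add: const algebra_simps abs_le_iff)
qed

lemma delta_integral_diff_limits:
  assumes "rd_regular g" "c \<in> X" "d \<in> X" "c \<le> d"
  shows "delta_integral T a d g - delta_integral T a c g = delta_integral T c d g"
  using delta_integral_split[of a c g d] assms a_in a_less_b
  by (simp add: rd_regular_set_integrable)

lemma continuous_on_delta_integral:
  assumes g: "rd_regular g" shows "continuous_on X (\<lambda>s. delta_integral T a s g)"
proof -
  let ?Q = "\<lambda>s. delta_integral T a s g"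
  obtain C where C: "0 \<le> C" "\<And>t. t \<in> Y \<Longrightarrow> \<bar>g t\<bar> \<le> C" using rd_regular_bound[OF g] by metis
  have Q: "\<bar>?Q d - ?Q c\<bar> \<le> C * (d - c)" if "c \<in> X" "d \<in> X" "c \<le> d" for c d
    using delta_integral_diff_limits[OF g that] delta_integral_approx[OF g that, of 0 C] C that by auto
  have "C-lipschitz_on X ?Q"
  proof (rule lipschitz_onI)
    fix x y assume "x \<in> X" "y \<in> X"
    then show "dist (?Q x) (?Q y) \<le> C * dist x y"
      using Q[of x y] Q[of y x] by (cases "x \<le> y") (auto simp: dist_real_def abs_minus_commute)
  qed (rule C)
  then show ?thesis by (rule lipschitz_on_continuous_on)
qed

text \<open>At a right-dense \<open>t\<close>, continuity of \<open>g\<close> makes its mean over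
  short intervals close to \<open>g t\<close>. At a right-scattered \<open>t\<close>, the interval
  from \<open>t\<close> to its jump contains no point of \<open>T\<close> but \<open>t\<close>, so
  the increment is exactly \<open>g t\<close> times the length of the gap.\<close>

lemma has_delta_derivative_delta_integral:
  assumes g: "rd_regular g" and t: "t \<in> T" "a \<le> t" "t < b"
  shows "has_delta_derivative T X (\<lambda>s. delta_integral T a s g) (g t) t"
proof -
  let ?Q = "\<lambda>s. delta_integral T a s g"
  have tX: "t \<in> X" and tY: "t \<in> Y" using t by auto
  show ?thesis
  proof (cases "fwd_jump T t = t")
    case True
    have "\<exists>\<delta>>0. \<forall>s\<in>X. \<bar>s - t\<bar> < \<delta> \<longrightarrow> \<bar>?Q t - ?Q s - g t * (t - s)\<bar> \<le> e * \<bar>t - s\<bar>"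
      if e: "e > 0" for e
    proof -
      have "continuous (at t within Y) g" using g tY True by (simp add: rd_regular_def)
      then obtain \<delta> where \<delta>: "\<delta> > 0" "\<And>s. s \<in> Y \<Longrightarrow> \<bar>s - t\<bar> < \<delta> \<Longrightarrow> \<bar>g s - g t\<bar> < e"
        using e unfolding continuous_within_eps_delta dist_real_def by blast
      have "\<bar>?Q t - ?Q s - g t * (t - s)\<bar> \<le> e * \<bar>t - s\<bar>" if s: "s \<in> X" "\<bar>s - t\<bar> < \<delta>" for s
      proof (cases "t \<le> s")
        case le: True
        have "\<bar>delta_integral T t s g - g t * (s - t)\<bar> \<le> e * (s - t)"
          using \<delta>(2) s t le by (intro delta_integral_approx g) (auto intro!: less_imp_le)
        then show ?thesis
          using delta_integral_diff_limits[OF g tX s(1) le] le by (simp add: algebra_simps abs_le_iff)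
      next
        case False
        then have le: "s \<le> t" by simp
        have "\<bar>delta_integral T s t g - g t * (t - s)\<bar> \<le> e * (t - s)"
          using \<delta>(2) s t le by (intro delta_integral_approx g) (auto intro!: less_imp_le)
        then show ?thesis
          using delta_integral_diff_limits[OF g s(1) tX le] le by (simp add: algebra_simps abs_le_iff)
      qed
      then show ?thesis using \<delta> by blast
    qed
    then show ?thesis using tX True kappa[OF t(1,3)] by (simp add: has_delta_derivative_def)
  next
    case False
    then have u: "t < fwd_jump T t" using fwd_jump_ge[of t T] by simp
    let ?u = "fwd_jump T t"
    have uX: "?u \<in> X" using fwd_jump_in_X t by blast
    have "\<bar>delta_integral T t ?u g - g t * (?u - t)\<bar> \<le> 0 * (?u - t)"
      using u uX tX by (intro delta_integral_approx g) (auto dest: fwd_jump_gap)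
    then have "?Q ?u - ?Q t = g t * (?u - t)"
      using delta_integral_diff_limits[OF g tX uX] u by simp
    moreover have "continuous (at t within X) ?Q"
      using continuous_on_delta_integral[OF g] tX by (simp add: continuous_on_eq_continuous_within)
    ultimately show ?thesis
      using has_delta_derivative_right_scattered[OF tX kappa[OF t(1,3)] u] by simp
  qed
qed

text \<open>The mean value inequality with the indefinite integral of \<open>g\<close> as majorant.
  Only \<open>g\<close> is integrated, so \<open>F'\<close> may be any derivative; this is how the
  second derivative of \<open>f\<close> enters.\<close>

lemma delta_integral_bound_increment:
  assumes cd: "c \<in> X" "d \<in> X" "c \<le> d"
    and cont: "continuous_on X F" and g: "rd_regular g"
    and der: "\<And>t. t \<in> Y \<Longrightarrow> has_delta_derivative T X F (F' t) t"
    and le: "\<And>t. t \<in> T \<Longrightarrow> c \<le> t \<Longrightarrow> t < d \<Longrightarrow> t \<noteq> c \<or> c < fwd_jump T c \<Longrightarrow> \<bar>F' t\<bar> \<le> g t"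
  shows "\<bar>F d - F c\<bar> \<le> delta_integral T c d g"
proof -
  have "\<bar>F d - F c\<bar> \<le> delta_integral T a d g - delta_integral T a c g"
    using cd by (intro delta_mean_value_inequality[where F' = F' and P' = g] cont der le
        continuous_on_delta_integral has_delta_derivative_delta_integral g) auto
  then show ?thesis using delta_integral_diff_limits[OF g cd] by simp
qed

text \<open>\<open>F\<close> minus the indefinite integral of \<open>F'\<close> has derivative 0, so
  its increments are bounded by the integral of 0.\<close>

lemma fundamental_theorem_delta_integral:
  assumes cd: "c \<in> X" "d \<in> X" "c \<le> d"
    and cont: "continuous_on X F" and reg: "rd_regular F'"
    and der: "\<And>t. t \<in> Y \<Longrightarrow> has_delta_derivative T X F (F' t) t"
  shows "delta_integral T c d F' = F d - F c"
proof -
  let ?G = "\<lambda>s. F s - delta_integral T a s F'"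
  have "\<bar>?G d - ?G c\<bar> \<le> delta_integral T c d (\<lambda>_. 0)"
  proof (rule delta_integral_bound_increment[where F' = "\<lambda>t. F' t - F' t"])
    show "continuous_on X ?G"
      by (intro continuous_intros cont continuous_on_delta_integral reg)
    show "has_delta_derivative T X ?G (F' t - F' t) t" if "t \<in> Y" for t
      using that by (intro has_delta_derivative_diff der has_delta_derivative_delta_integral reg) auto
  qed (use cd rd_regular_const in auto)
  then show ?thesis
    using delta_integral_diff_limits[OF reg cd] by (simp add: delta_integral_def)
qed

text \<open>The kernel may jump at a right-dense \<open>x\<close> and then fails to be
  \<open>rd_regular\<close>. Splitting at \<open>x\<close> leaves a regular integrand on either
  side.\<close>

lemma delta_integral_piecewise:
  assumes h: "rd_regular h1" "rd_regular h2" and x: "x \<in> X"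
  shows "set_integrable (delta_measure T) Y (\<lambda>t. if t < x then h1 t else h2 t)" (is ?int)
    and "delta_integral T a b (\<lambda>t. if t < x then h1 t else h2 t)
      = delta_integral T a x h1 + delta_integral T x b h2" (is ?eq)
proof -
  let ?k = "\<lambda>t. if t < x then h1 t else h2 t"
  have ab: "a \<in> X" "b \<in> X" "a \<le> x" "x \<le> b" using a_in b_in a_less_b x by auto
  have i1: "set_integrable (delta_measure T) (T \<inter> {a..<x}) ?k"
    using rd_regular_set_integrable[OF h(1) ab(1) x ab(3)]
    by (rule set_integrable_cong[THEN iffD1, rotated -1]) auto
  have i2: "set_integrable (delta_measure T) (T \<inter> {x..<b}) ?k"
    using rd_regular_set_integrable[OF h(2) x ab(2,4)]
    by (rule set_integrable_cong[THEN iffD1, rotated -1]) auto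
  have "Y = (T \<inter> {a..<x}) \<union> (T \<inter> {x..<b})" using ab by auto
  then show ?int
    using set_integrable_Un[OF i1 i2] measure_Ico(1)[OF ab(1) x ab(3)] measure_Ico(1)[OF x ab(2,4)]
    by simp
  have "delta_integral T a x ?k = delta_integral T a x h1"
    unfolding delta_integral_def
    using measure_Ico(1)[OF ab(1) x ab(3)] by (intro set_lebesgue_integral_cong) auto
  moreover have "delta_integral T x b ?k = delta_integral T x b h2"
    unfolding delta_integral_def
    using measure_Ico(1)[OF x ab(2,4)] by (intro set_lebesgue_integral_cong) auto
  ultimately show ?eq
    using delta_integral_split[OF i1 i2] ab by simp
qed

text \<open>If the integral of a positive function vanished, \<open>Y\<close> would be a null set,
  but its measure is \<open>b - a > 0\<close>.\<close>

lemma delta_integral_pos: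
  assumes g: "rd_regular g" and pos: "\<And>t. t \<in> Y \<Longrightarrow> 0 < g t"
  shows "0 < delta_integral T a b g"
proof -
  let ?F = "\<lambda>t. indicator Y t *\<^sub>R g t"
  have ab: "a \<in> X" "b \<in> X" "a \<le> b" using a_in b_in a_less_b by auto
  have int: "integrable (delta_measure T) ?F"
    using rd_regular_set_integrable[OF g ab] by (simp add: set_integrable_def)
  have nn: "AE t in delta_measure T. 0 \<le> ?F t"
    using pos by (intro AE_I2) (auto simp: indicator_def intro: less_imp_le)
  have "delta_integral T a b g \<noteq> 0"
  proof
    assume "delta_integral T a b g = 0"
    then have "AE t in delta_measure T. ?F t = 0"
      using integral_nonneg_eq_0_iff_AE[OF int nn] by (simp add: delta_integral_def set_lebesgue_integral_def)
    then have "AE t in delta_measure T. t \<notin> Y"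
      by eventually_elim (use pos in \<open>fastforce simp: indicator_def split: if_splits\<close>)
    then have "emeasure (delta_measure T) Y = 0"
      using measure_Ico(1)[OF ab] by (subst (asm) AE_iff_null_sets[symmetric]) auto
    then show False using measure_Ico(3)[OF ab] a_less_b by (simp add: measure_def)
  qed
  moreover have "0 \<le> delta_integral T a b g"
    unfolding delta_integral_def set_lebesgue_integral_def by (rule integral_nonneg_AE[OF nn])
  ultimately show ?thesis by simp
qed

text \<open>The subtracted integral cancels the term \<open>\<nu> t * f (fwd_jump T t)\<close> of
  the product rule. The constant \<open>k\<close> is free and takes a different value on each branch
  of the kernel.\<close>

lemma has_delta_derivative_by_parts:
  assumes "rd_regular \<nu>" "continuous_on X f" "t \<in> Y"
    and "has_delta_derivative T X w (\<nu> t) t" "has_delta_derivative T X f (f' t) t"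
  shows "has_delta_derivative T X
    (\<lambda>s. (w s - k) * f s - delta_integral T a s (\<lambda>s. \<nu> s * f (fwd_jump T s))) ((w t - k) * f' t) t"
proof -
  have "rd_regular (\<lambda>s. \<nu> s * f (fwd_jump T s))"
    using assms by (intro rd_regular_mult rd_regular_fwd_jump)
  then have "has_delta_derivative T X (\<lambda>s. delta_integral T a s (\<lambda>s. \<nu> s * f (fwd_jump T s)))
      (\<nu> t * f (fwd_jump T t)) t"
    using assms(3) by (intro has_delta_derivative_delta_integral) auto
  from has_delta_derivative_diff[OF has_delta_derivative_mult[OF
        has_delta_derivative_diff_const[OF assms(4)] assms(5)] this]
  show ?thesis by simp
qed

end

section \<open>The Montgomery identity and the double integral bound\<close>

text \<open>The terms \<open>Qx\<close> cancel, and with \<open>N = wb - wa\<close> the coefficients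
  are \<open>c2 - c1 = N * (1 + q - p) / 2\<close> at \<open>fx\<close>,
  \<open>c1 - wa = N * p / 2\<close> at \<open>fa\<close> and
  \<open>wb - c2 = N * (1 - q) / 2\<close> at \<open>fb\<close>. The 0 stands for the integral from
  \<open>a\<close> to \<open>a\<close>.\<close>

lemma montgomery_boundary_terms:
  fixes wa wb wx p q fa fb fx Q Qx :: real
  defines "c1 \<equiv> wa + p * ((wb - wa) / 2)" and "c2 \<equiv> wa + (1 + q) * ((wb - wa) / 2)"
  shows "((wx - c1) * fx - Qx) - ((wa - c1) * fa - 0) + (((wb - c2) * fb - Q) - ((wx - c2) * fx - Qx))
    = (wb - wa) * ((1 + q - p) / 2 * fx + (p * fa + (1 - q) * fb) / 2) - Q"
  by (simp add: c1_def c2_def field_simps)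

theorem theorem16:
  fixes T :: "real set" and a b M :: real
    and \<nu> w f f' f'' \<psi> :: "real \<Rightarrow> real"
  assumes "time_scale T" and "a \<in> T" and "b \<in> T" and "a < b"
    and "rd_continuous_on T (T \<inter> {a..b}) \<nu>"
    and "\<And>t. t \<in> T \<inter> {a..b} \<Longrightarrow> 0 < \<nu> t"
    and "\<And>t. t \<in> T \<inter> {a..b} \<Longrightarrow> has_delta_derivative T (T \<inter> {a..b}) w (\<nu> t) t"
    and "\<And>t. t \<in> T \<inter> {a..b} \<Longrightarrow> has_delta_derivative T (T \<inter> {a..b}) f (f' t) t"
    and "\<And>t. t \<in> T \<inter> {a..b} \<Longrightarrow> has_delta_derivative T (T \<inter> {a..b}) f' (f'' t) t"
    and "\<And>l. l \<in> {0..1} \<Longrightarrow> \<psi> l \<in> {0..1}"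
    and "bdd_above ((\<lambda>t. \<bar>f'' t\<bar>) ` sup_points T a b)"
    and "M = (SUP t\<in>sup_points T a b. \<bar>f'' t\<bar>)"
  shows "\<forall>x \<in> T \<inter> {a..b}. \<forall>l \<in> {0..1}.
    (let K = montgomery_kernel w a b \<psi> l; \<Phi> = phi_weight \<psi> l; N = delta_integral T a b \<nu> in
      \<bar>\<Phi>^2 * f x
        - 1 / N^2 * delta_integral T a b (\<lambda>t. K t x)
            * delta_integral T a b (\<lambda>s. \<nu> s * f' (fwd_jump T s))
        + (\<psi> l * f' a + (1 - \<psi> (1 - l)) * f' b) / (2 * N) * delta_integral T a b (\<lambda>t. K t x)
        - \<Phi> / N * delta_integral T a b (\<lambda>t. \<nu> t * f (fwd_jump T t))
        + (\<psi> l * f a + (1 - \<psi> (1 - l)) * f b) / 2 * \<Phi>\<bar>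
      \<le> M / N^2 * delta_integral T a b (\<lambda>t. delta_integral T a b (\<lambda>s. \<bar>K t x\<bar> * \<bar>K s t\<bar>)))"
proof -
  interpret time_scale_interval T a b
    using assms(1-4) by unfold_locales (auto simp: time_scale_def)
  have ab: "a \<in> X" "b \<in> X" "a \<le> b" using assms(2-4) by auto
  have reg_nu: "rd_regular \<nu>" using assms(5) by (rule rd_regular_rd_continuous)
  have cont: "continuous_on X w" "continuous_on X f" "continuous_on X f'"
    unfolding continuous_on_eq_continuous_within
    using has_delta_derivative_continuous[OF assms(7)] has_delta_derivative_continuous[OF assms(8)]
      has_delta_derivative_continuous[OF assms(9)] by blast+
  \<comment> \<open>Here \<open>c\<close> is the left end of a subinterval. If \<open>t = a\<close>
    then \<open>c = a\<close> as well, and the proviso makes \<open>a\<close> right-scattered, which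
    is the case in which \<open>sup_points\<close> contains it.\<close>
  have M: "\<bar>f'' t\<bar> \<le> M" if "t \<in> T" "a \<le> t" "t < b" "t \<noteq> c \<or> c < fwd_jump T c" "a \<le> c" "c \<le> t" for t c
  proof -
    have "t \<in> sup_points T a b"
      using that by (cases "t = a") (auto simp: sup_points_def)
    then show ?thesis unfolding assms(12) using assms(11) by (intro cSUP_upper)
  qed
  have N: "delta_integral T a b \<nu> = w b - w a"
    using ab by (intro fundamental_theorem_delta_integral cont reg_nu assms(7)) auto
  have "0 < delta_integral T a b \<nu>"
    using assms(6) by (intro delta_integral_pos reg_nu) auto
  then have N_pos: "0 < w b - w a" unfolding N .
  show ?thesis
    unfolding Let_def N
  proof (intro ballI)
    fix x l :: real assume x: "x \<in> X" and l: "l \<in> {0..1}"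
    define N where "N = w b - w a"
    define c1 where "c1 = w a + \<psi> l * ((w b - w a) / 2)"
    define c2 where "c2 = w a + (1 + \<psi> (1 - l)) * ((w b - w a) / 2)"
    define \<Phi> where "\<Phi> = phi_weight \<psi> l"
    define K where "K = montgomery_kernel w a b \<psi> l"
    define S where "S t = delta_integral T a b (\<lambda>s. \<bar>K s t\<bar>)" for t
    define Q where "Q h s = delta_integral T a s (\<lambda>s. \<nu> s * h (fwd_jump T s))" for h s
    define A where "A h = (\<psi> l * h a + (1 - \<psi> (1 - l)) * h b) / 2" for h :: "real \<Rightarrow> real"
    \<comment> \<open>\<open>H h k\<close> is an antiderivative of \<open>(w - k) * h'\<close>. The
      kernel \<open>K s t\<close> is \<open>w s - c1\<close> before \<open>t\<close> and
      \<open>w s - c2\<close> from \<open>t\<close> on, so integrals against it become increments of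
      \<open>H h c1\<close> and \<open>H h c2\<close>.\<close>
    define H where "H h k s = (w s - k) * h s - Q h s" for h k s
    define J where "J = delta_integral T a b (\<lambda>t. K t x)"
    have A2: "2 * A h = \<psi> l * h a + (1 - \<psi> (1 - l)) * h b" for h
      by (simp add: A_def)
    have N0: "N > 0" using N_pos by (simp add: N_def)
    have K_eq: "K s t = (if s < t then w s - c1 else w s - c2)" for s t
      by (simp add: K_def montgomery_kernel_def c1_def c2_def)
    have K_mult: "K s t * r = (if s < t then (w s - c1) * r else (w s - c2) * r)"
      "\<bar>K s t\<bar> * r = (if s < t then \<bar>w s - c1\<bar> * r else \<bar>w s - c2\<bar> * r)" for s t r
      by (simp_all add: K_eq)
    have w_reg: "rd_regular (\<lambda>s. w s - k)" for k
      by (intro rd_regular_continuous_on continuous_intros cont)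
    have Qa: "Q h a = 0" for h by (simp add: Q_def delta_integral_def set_lebesgue_integral_def)
    have H_sum: "(H h c1 t - H h c1 a) + (H h c2 b - H h c2 t) = N * (\<Phi> * h t + A h) - Q h b" for h t
      unfolding H_def Qa c1_def c2_def N_def \<Phi>_def phi_weight_def A_def
      by (rule montgomery_boundary_terms)
    have H_cont: "continuous_on X (H h k)" if "continuous_on X h" for h k
      unfolding H_def[abs_def] Q_def using that cont reg_nu
      by (intro continuous_intros continuous_on_delta_integral rd_regular_mult rd_regular_fwd_jump)
    have H_der: "has_delta_derivative T X (H h k) ((w t - k) * h' t) t"
      if "continuous_on X h" "t \<in> Y" "has_delta_derivative T X h (h' t) t" for h h' k t
      unfolding H_def[abs_def] Q_def
      using that assms(7) by (intro has_delta_derivative_by_parts reg_nu) auto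
    have le: "a \<le> t" "t \<le> b" if "t \<in> X" for t using that by auto

    have identity: "delta_integral T a b (\<lambda>t. K t x * f' t) = N * (\<Phi> * f x + A f) - Q f b"
    proof -
      have reg: "rd_regular (\<lambda>t. (w t - k) * f' t)" for k
        by (intro rd_regular_mult w_reg rd_regular_continuous_on cont)
      have "delta_integral T c d (\<lambda>t. (w t - k) * f' t) = H f k d - H f k c"
        if "c \<in> X" "d \<in> X" "c \<le> d" for c d k
        using that assms(8) by (intro fundamental_theorem_delta_integral reg H_cont H_der cont) auto
      from this[OF ab(1) x, of c1] this[OF x ab(2), of c2]
      have "delta_integral T a b (\<lambda>t. if t < x then (w t - c1) * f' t else (w t - c2) * f' t)
          = N * (\<Phi> * f x + A f) - Q f b"
        unfolding delta_integral_piecewise(2)[OF reg reg x] H_sum[symmetric] using le[OF x] by simp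
      then show ?thesis unfolding K_mult .
    qed

    have S_eq: "S t = delta_integral T a t (\<lambda>s. \<bar>w s - c1\<bar>) + delta_integral T t b (\<lambda>s. \<bar>w s - c2\<bar>)"
      if "t \<in> X" for t
      unfolding S_def K_eq if_distrib[where f = abs]
      by (intro delta_integral_piecewise(2) rd_regular_abs w_reg that)
    have S_cont: "continuous_on X S"
    proof -
      \<comment> \<open>The lower limit \<open>t\<close> is moved into a difference of integrals
        starting at \<open>a\<close>, whose continuity in \<open>t\<close> is known.\<close>
      have eq: "S t = delta_integral T a t (\<lambda>s. \<bar>w s - c1\<bar>)
          + (delta_integral T a b (\<lambda>s. \<bar>w s - c2\<bar>) - delta_integral T a t (\<lambda>s. \<bar>w s - c2\<bar>))"
        if "t \<in> X" for t
        using S_eq[OF that] delta_integral_diff_limits[OF rd_regular_abs[OF w_reg] that ab(2)] that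
        by simp
      have "continuous_on X (\<lambda>t. delta_integral T a t (\<lambda>s. \<bar>w s - c1\<bar>)
          + (delta_integral T a b (\<lambda>s. \<bar>w s - c2\<bar>) - delta_integral T a t (\<lambda>s. \<bar>w s - c2\<bar>)))"
        by (intro continuous_intros continuous_on_delta_integral rd_regular_abs w_reg)
      then show ?thesis by (rule continuous_on_cong[THEN iffD2, rotated -1]) (use eq in auto)
    qed

    \<comment> \<open>By the identity for \<open>f'\<close>, this is what the integral of
      \<open>K s t * f'' s\<close> over \<open>s\<close> would be. It is written through boundary
      terms so that it is continuous and can be integrated in \<open>t\<close>.\<close>
    define G where "G t = N * (\<Phi> * f' t + A f') - Q f' b" for t
    have G_le: "\<bar>G t\<bar> \<le> M * S t" if t: "t \<in> X" for t
    proof -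
      have "\<bar>H f' k d - H f' k c\<bar> \<le> delta_integral T c d (\<lambda>s. M * \<bar>w s - k\<bar>)"
        if cd: "c \<in> X" "d \<in> X" "c \<le> d" for c d k
      proof (rule delta_integral_bound_increment[OF cd H_cont[OF cont(3)]])
        show "has_delta_derivative T X (H f' k) ((w t - k) * f'' t) t" if "t \<in> Y" for t
          using that assms(9) by (intro H_der cont) auto
        show "rd_regular (\<lambda>s. M * \<bar>w s - k\<bar>)"
          by (intro rd_regular_mult rd_regular_const rd_regular_abs w_reg)
        show "\<bar>(w t - k) * f'' t\<bar> \<le> M * \<bar>w t - k\<bar>"
          if "t \<in> T" "c \<le> t" "t < d" "t \<noteq> c \<or> c < fwd_jump T c" for t
          using M[of t c] that cd by (simp add: abs_mult mult.commute mult_right_mono)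
      qed
      then have "\<bar>H f' k d - H f' k c\<bar> \<le> M * delta_integral T c d (\<lambda>s. \<bar>w s - k\<bar>)"
        if "c \<in> X" "d \<in> X" "c \<le> d" for c d k
        using that by (simp add: delta_integral_def)
      \<comment> \<open>The two increments are bounded with \<open>c1\<close> on the part before
        \<open>t\<close> and with \<open>c2\<close> on the part after it; the two bounds add up to
        \<open>M * S t\<close>.\<close>
      from this[OF ab(1) t, of c1] this[OF t ab(2), of c2]
      have "\<bar>(H f' c1 t - H f' c1 a) + (H f' c2 b - H f' c2 t)\<bar> \<le> M * S t"
        using le[OF t] unfolding S_eq[OF t] distrib_left by linarith
      then show ?thesis unfolding H_sum G_def .
    qed

    have K_int: "set_integrable (delta_measure T) Y (\<lambda>t. K t x * h t)"
      "set_integrable (delta_measure T) Y (\<lambda>t. \<bar>K t x\<bar> * h t)" if "continuous_on X h" for h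
    proof -
      have h: "rd_regular h" using that by (rule rd_regular_continuous_on)
      show "set_integrable (delta_measure T) Y (\<lambda>t. K t x * h t)"
        using delta_integral_piecewise(1)[OF rd_regular_mult[OF w_reg h] rd_regular_mult[OF w_reg h] x]
        unfolding K_mult .
      show "set_integrable (delta_measure T) Y (\<lambda>t. \<bar>K t x\<bar> * h t)"
        using delta_integral_piecewise(1)[OF rd_regular_mult[OF rd_regular_abs[OF w_reg] h]
            rd_regular_mult[OF rd_regular_abs[OF w_reg] h] x]
        unfolding K_mult .
    qed
    have G_cont: "continuous_on X G" unfolding G_def[abs_def] by (intro continuous_intros cont)
    \<comment> \<open>\<open>G\<close> is affine in \<open>f'\<close>, so the integral against
      \<open>K t x\<close> reduces to the identity for \<open>f\<close> and to \<open>J\<close>. The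
      factor 1 lets \<open>K_int\<close> cover the constant term too.\<close>
    have "delta_integral T a b (\<lambda>t. K t x * G t)
        = delta_integral T a b (\<lambda>t. N * \<Phi> * (K t x * f' t) + (N * A f' - Q f' b) * (K t x * 1))"
      by (simp add: G_def algebra_simps)
    also have "\<dots> = N * \<Phi> * delta_integral T a b (\<lambda>t. K t x * f' t)
        + (N * A f' - Q f' b) * delta_integral T a b (\<lambda>t. K t x * 1)"
      unfolding delta_integral_def using K_int(1)[OF cont(3)] K_int(1)[of "\<lambda>_. 1"]
      by (subst set_integral_add) (auto intro!: set_integrable_mult_right)
    also have "\<dots> = N * \<Phi> * (N * (\<Phi> * f x + A f) - Q f b) + (N * A f' - Q f' b) * J"
      by (simp add: identity J_def)
    finally have int_G: "delta_integral T a b (\<lambda>t. K t x * G t) = \<dots>" .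
    have SM: "continuous_on X (\<lambda>t. M * S t)" by (intro continuous_intros S_cont)
    have "\<bar>delta_integral T a b (\<lambda>t. K t x * G t)\<bar> \<le> delta_integral T a b (\<lambda>t. \<bar>K t x\<bar> * (M * S t))"
    proof -
      have bd: "\<bar>K t x * G t\<bar> \<le> \<bar>K t x\<bar> * (M * S t)" if "t \<in> Y" for t
        unfolding abs_mult using that by (intro mult_left_mono G_le) auto
      have "delta_integral T a b (\<lambda>t. K t x * G t) \<le> delta_integral T a b (\<lambda>t. \<bar>K t x\<bar> * (M * S t))"
        unfolding delta_integral_def
        by (intro set_integral_mono K_int G_cont SM) (use bd in \<open>force simp: abs_le_iff\<close>)
      \<comment> \<open>The bound for \<open>- G\<close> supplies the other half of the absolute
        value.\<close>
      moreover have "delta_integral T a b (\<lambda>t. K t x * (- G t)) \<le> delta_integral T a b (\<lambda>t. \<bar>K t x\<bar> * (M * S t))"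
        unfolding delta_integral_def
        by (intro set_integral_mono K_int continuous_intros G_cont SM) (use bd in \<open>force simp: abs_le_iff\<close>)
      ultimately show ?thesis by (simp add: delta_integral_def set_lebesgue_integral_def)
    qed
    also have "\<dots> = M * delta_integral T a b (\<lambda>t. \<bar>K t x\<bar> * S t)"
      by (simp add: delta_integral_def mult.left_commute)
    also have "(\<lambda>t. \<bar>K t x\<bar> * S t) = (\<lambda>t. delta_integral T a b (\<lambda>s. \<bar>K t x\<bar> * \<bar>K s t\<bar>))"
      by (simp add: S_def delta_integral_def)
    finally have main: "\<bar>N * \<Phi> * (N * (\<Phi> * f x + A f) - Q f b) + (N * A f' - Q f' b) * J\<bar>
        \<le> M * delta_integral T a b (\<lambda>t. delta_integral T a b (\<lambda>s. \<bar>K t x\<bar> * \<bar>K s t\<bar>))"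
      unfolding int_G .
    \<comment> \<open>Dividing by the square of \<open>N\<close> yields the expression to be
      estimated; \<open>2 * A f' / (2 * N)\<close> is kept unreduced to match its shape.\<close>
    have "\<Phi>\<^sup>2 * f x - 1 / N\<^sup>2 * J * Q f' b + 2 * A f' / (2 * N) * J - \<Phi> / N * Q f b + A f * \<Phi>
        = (N * \<Phi> * (N * (\<Phi> * f x + A f) - Q f b) + (N * A f' - Q f' b) * J) / N\<^sup>2"
      using N0 by (simp add: field_simps power2_eq_square)
    then have "\<bar>\<Phi>\<^sup>2 * f x - 1 / N\<^sup>2 * J * Q f' b + 2 * A f' / (2 * N) * J - \<Phi> / N * Q f b + A f * \<Phi>\<bar>
        \<le> M * delta_integral T a b (\<lambda>t. delta_integral T a b (\<lambda>s. \<bar>K t x\<bar> * \<bar>K s t\<bar>)) / N\<^sup>2"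
      using divide_right_mono[OF main, of "N\<^sup>2"] by simp
    then show "\<bar>(phi_weight \<psi> l)\<^sup>2 * f x
        - 1 / (w b - w a)\<^sup>2 * delta_integral T a b (\<lambda>t. montgomery_kernel w a b \<psi> l t x)
            * delta_integral T a b (\<lambda>s. \<nu> s * f' (fwd_jump T s))
        + (\<psi> l * f' a + (1 - \<psi> (1 - l)) * f' b) / (2 * (w b - w a))
            * delta_integral T a b (\<lambda>t. montgomery_kernel w a b \<psi> l t x)
        - phi_weight \<psi> l / (w b - w a) * delta_integral T a b (\<lambda>t. \<nu> t * f (fwd_jump T t))
        + (\<psi> l * f a + (1 - \<psi> (1 - l)) * f b) / 2 * phi_weight \<psi> l\<bar>
      \<le> M / (w b - w a)\<^sup>2 * delta_integral T a b (\<lambda>t. delta_integral T a b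
            (\<lambda>s. \<bar>montgomery_kernel w a b \<psi> l t x\<bar> * \<bar>montgomery_kernel w a b \<psi> l s t\<bar>))"
      unfolding A2 unfolding J_def Q_def A_def \<Phi>_def K_def N_def by simp
  qed
qed

end
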